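(* Let $n$ be a positive integer. Let $A\in M_n(\mathbb{C})$ be such that $\mathrm{Tr}(A)\ge 0$ and $\mathrm{Re}(A)\le S$ for some self-adjoint $S\in M_n(\mathbb{C})$, and let $\{A_m\}_{m=1}^\infty$ be a sequence in $M_n(\mathbb{C})$ such that $\mathrm{Tr}(SA_m)=0$, $\mathrm{Tr}(AA_m)=0$ and $\|A_m\|\le 1$ for all $m\ge 1$. Put $\alpha_0=\mathrm{Tr}(A)$ and $\alpha_m=\mathrm{Tr}(AA_m^* )$ for $m\ge 1$. Then $$\sum_{m=0}^\infty|\alpha_m|r^m\le \mathrm{Tr}(S)$$ whenever $0\le r\le\frac13$. Moreover, for every $n\ge 2$, $\frac13$ is the optimal bound for $r$: for every $n\ge 2$ and every $r>\frac13$ there exist $A\in M_n(\mathbb{C})$ with $\mathrm{Tr}(A)\ge 0$, a self-adjoint $S\in M_n(\mathbb{C})$ with $\mathrm{Re}(A)\le S$, and a sequence $\{A_m\}_{m=1}^\infty$ in $M_n(\mathbb{C})$ with $\mathrm{Tr}(SA_m)=0$, $\mathrm{Tr}(AA_m)=0$ and $\|A_m\|\le 1$ for all $m\ge 1$, for which the inequality $\sum_{m=0}^\infty|\alpha_m|r^m\le \mathrm{Tr}(S)$ (with $\alpha_0=\mathrm{Tr}(A)$ and $\alpha_m=\mathrm{Tr}(AA_m^* )$ for $m\ge 1$) fails.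
   Context: $\mathrm{Re}(A)=\frac12(A+A^* )$; $\le$ between matrices is the usual (Loewner) order on self-adjoint matrices; $\mathrm{Tr}$ is the usual (unnormalized) trace and $\|\cdot\|$ the operator norm on $M_n(\mathbb{C})=B(\mathbb{C}^n)$. A divergent left-hand side counts as failure of the inequality. *)

theory Defs
  imports "HOL-Analysis.Analysis"
begin

(* M_n(C) is "complex^'n^'n" with n = CARD('n); the norm of the library on "complex^'n" is
   the Euclidean norm of C^n. *)

definition conj_transpose :: "complex^'n^'n \<Rightarrow> complex^'n^'n" where
  "conj_transpose A = (\<chi> i j. cnj (A $ j $ i))"

definition selfadjoint :: "complex^'n^'n \<Rightarrow> bool" where
  "selfadjoint A \<longleftrightarrow> conj_transpose A = A"

definition re_part :: "complex^'n^'n \<Rightarrow> complex^'n^'n" where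
  "re_part A = (1/2) *\<^sub>R (A + conj_transpose A)"

definition quad_form :: "complex^'n^'n \<Rightarrow> complex^'n \<Rightarrow> complex" where
  "quad_form A x = (\<Sum>i\<in>UNIV. cnj (x $ i) * (A *v x) $ i)"

definition pos_semidef :: "complex^'n^'n \<Rightarrow> bool" where
  "pos_semidef A \<longleftrightarrow> selfadjoint A \<and> (\<forall>x. quad_form A x \<in> \<real> \<and> 0 \<le> Re (quad_form A x))"

definition loewner_le :: "complex^'n^'n \<Rightarrow> complex^'n^'n \<Rightarrow> bool" where
  "loewner_le A B \<longleftrightarrow> selfadjoint A \<and> selfadjoint B \<and> pos_semidef (B - A)"

definition op_norm :: "complex^'n^'n \<Rightarrow> real" where
  "op_norm A = onorm (\<lambda>x. A *v x)"

(* The sequence (A_m) is indexed by m \<ge> 1; the value of the function B at 0 is never used. *)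

definition coeff_seq :: "complex^'n^'n \<Rightarrow> (nat \<Rightarrow> complex^'n^'n) \<Rightarrow> nat \<Rightarrow> complex" where
  "coeff_seq A B m = (if m = 0 then trace A else trace (A ** conj_transpose (B m)))"

(* Summability is part of the inequality, since suminf of a divergent series is unspecified.
   The trace of a self-adjoint S is real, so Re (trace S) is that trace. *)

definition bohr_ineq ::
    "complex^'n^'n \<Rightarrow> complex^'n^'n \<Rightarrow> (nat \<Rightarrow> complex^'n^'n) \<Rightarrow> real \<Rightarrow> bool" where
  "bohr_ineq S A B r \<longleftrightarrow>
     summable (\<lambda>m. cmod (coeff_seq A B m) * r ^ m) \<and>
     (\<Sum>m. cmod (coeff_seq A B m) * r ^ m) \<le> Re (trace S)"

end

theory Submission
  imports Defs
begin

text \<open>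
  Put \<open>P = S - re_part A\<close>, a positive semidefinite matrix with trace \<open>Tr S - Tr A\<close>.  The two trace
  conditions give \<open>Tr (A B\<^sup>*) = - 2 Tr (P B\<^sup>*)\<close> for every \<open>B = B m\<close>, whence
  \<open>\<bar>\<alpha>\<^sub>m\<bar> \<le> 2 (Tr S - Tr A)\<close> for \<open>m \<ge> 1\<close>, and the geometric series bounds the sum by \<open>Tr S\<close> as soon as
  \<open>r / (1 - r) \<le> 1/2\<close>.

  For optimality fix \<open>0 < c < 1\<close> and put \<open>e = 1 - c\<close>.  In terms of matrix units take
  \<open>A = - (2 c / e) E\<^sub>1\<^sub>2\<close>, \<open>S = E\<^sub>1\<^sub>1 - (c / e) (E\<^sub>1\<^sub>2 + E\<^sub>2\<^sub>1)\<close> and \<open>B m = c E\<^sub>1\<^sub>1 + e E\<^sub>1\<^sub>2\<close> for all \<open>m\<close>.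
  Then \<open>\<alpha>\<^sub>0 = 0\<close>, \<open>\<bar>\<alpha>\<^sub>m\<bar> = 2 c\<close> and \<open>Tr S = 1\<close>, so the inequality forces \<open>2 c r / (1 - r) \<le> 1\<close>;
  let \<open>c\<close> tend to \<open>1\<close>.
\<close>

section \<open>Quadratic forms, adjoints and the operator norm\<close>

lemma quad_form_double_sum:
  "quad_form A x = (\<Sum>i\<in>UNIV. \<Sum>j\<in>UNIV. cnj (x $ i) * A $ i $ j * x $ j)"
  by (simp add: quad_form_def matrix_vector_mult_def sum_distrib_left mult.assoc)

lemma selfadjoint_iff: "selfadjoint A \<longleftrightarrow> (\<forall>i j. cnj (A $ j $ i) = A $ i $ j)"
  by (auto simp: selfadjoint_def conj_transpose_def vec_eq_iff)

lemma re_part_nth: "re_part A $ i $ j = (A $ i $ j + cnj (A $ j $ i)) / 2"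
  unfolding re_part_def conj_transpose_def vector_scaleR_component by (simp add: scaleR_conv_of_real)

lemma trace_conj_transpose: "trace (conj_transpose A) = cnj (trace A)"
  by (simp add: trace_def conj_transpose_def)

lemma conj_transpose_mult: "conj_transpose (A ** B) = conj_transpose B ** conj_transpose A"
  by (simp add: conj_transpose_def matrix_matrix_mult_def vec_eq_iff mult.commute)

lemma conj_transpose_conj_transpose: "conj_transpose (conj_transpose A) = A"
  by (simp add: conj_transpose_def vec_eq_iff)

text \<open>Cauchy-Schwarz bounds the form by \<open>norm x * norm (B *v x)\<close>, and the
  operator norm controls the second factor.\<close>

lemma norm_quad_form_le:
  fixes B :: "complex^'n^'n"
  assumes "op_norm B \<le> 1"
  shows "cmod (quad_form B x) \<le> (norm x)\<^sup>2"
proof -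
  have bl: "bounded_linear (\<lambda>x. B *v x)"
    by (rule matrix_vector_mul_bounded_linear)
  have "cmod (quad_form B x) \<le> (\<Sum>i\<in>UNIV. cmod (cnj (x $ i) * (B *v x) $ i))"
    unfolding quad_form_def by (rule norm_sum)
  also have "\<dots> = (\<Sum>i\<in>UNIV. \<bar>cmod (x $ i)\<bar> * \<bar>cmod ((B *v x) $ i)\<bar>)"
    by (simp add: norm_mult)
  also have "\<dots> \<le> norm x * norm (B *v x)"
    unfolding norm_vec_def by (rule L2_set_mult_ineq)
  also have "norm (B *v x) \<le> onorm (\<lambda>x. B *v x) * norm x"
    by (rule onorm[OF bl])
  also have "\<dots> \<le> 1 * norm x"
    using assms by (intro mult_right_mono) (auto simp: op_norm_def)
  finally show ?thesis
    by (simp add: power2_eq_square mult_left_mono)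
qed

section \<open>Positive semidefinite matrices, Schur complements and the trace bound\<close>

text \<open>Changing one coordinate is the only perturbation used below: \<open>t\<close> is chosen
  to read off a diagonal entry, to force an entry to vanish, or to complete a square.\<close>

lemma quad_form_add_axis:
  fixes P :: "complex^'n^'n"
  assumes "selfadjoint P"
  shows "quad_form P (x + axis i t) = quad_form P x + cnj t * (P *v x) $ i
      + cnj ((P *v x) $ i) * t + cnj t * P $ i $ i * t"
proof -
  have sa: "cnj (P $ a $ b) = P $ b $ a" for a b
    using assms by (simp add: selfadjoint_iff)
  have mv: "(P *v axis i t) $ a = P $ a $ i * t" for a
    by (simp add: matrix_vector_mult_def axis_def if_distrib[of "\<lambda>z. _ * z"] cong: if_cong)
  have inn: "(\<Sum>a\<in>UNIV. cnj (axis i t $ a) * f a) = cnj t * f i" for f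
    by (simp add: axis_def if_distrib[of cnj] if_distrib[of "\<lambda>z. z * _"] cong: if_cong)
  have "(\<Sum>a\<in>UNIV. cnj (x $ a) * (P $ a $ i * t)) = cnj ((P *v x) $ i) * t"
    by (simp add: matrix_vector_mult_def sum_distrib_right sa mult.assoc mult.left_commute)
  then show ?thesis
    by (simp add: quad_form_def matrix_vector_right_distrib ring_distribs sum.distrib mv inn)
qed

lemma pos_semidef_diag:
  assumes "pos_semidef P"
  shows "P $ i $ i \<in> \<real>" "0 \<le> Re (P $ i $ i)"
proof -
  \<comment> \<open>The summand \<open>0\<close> puts the unit vector into the shape of
    \<open>quad_form_add_axis\<close>; only the last term survives.\<close>
  have "quad_form P (0 + axis i 1) = P $ i $ i"
    using assms by (subst quad_form_add_axis) (auto simp: pos_semidef_def quad_form_double_sum)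
  with assms show "P $ i $ i \<in> \<real>" "0 \<le> Re (P $ i $ i)"
    by (metis pos_semidef_def)+
qed

text \<open>With zero diagonal the form is purely off-diagonal, so a nonzero entry
  \<open>P $ i $ j\<close> would make it negative at the test vector
  \<open>axis j 1 + axis i (- (P $ i $ j))\<close>.\<close>

lemma pos_semidef_eq_0:
  fixes P :: "complex^'n^'n"
  assumes P: "pos_semidef P" and diag: "\<And>i. P $ i $ i = 0"
  shows "P = 0"
proof -
  have sa: "selfadjoint P" using P by (simp add: pos_semidef_def)
  have "P $ i $ j = 0" for i j
  proof -
    have "quad_form P (0 + axis j 1) = 0"
      using sa by (subst quad_form_add_axis) (auto simp: diag quad_form_double_sum)
    moreover have "(P *v axis j 1) $ i = P $ i $ j"
      by (simp add: matrix_vector_mult_def axis_def if_distrib[of "\<lambda>z. _ * z"] cong: if_cong)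
    ultimately have "quad_form P (axis j 1 + axis i (- (P $ i $ j)))
        = - 2 * complex_of_real ((cmod (P $ i $ j))\<^sup>2)"
      using sa by (simp add: quad_form_add_axis diag complex_norm_square
            del: of_real_power)
    moreover have "0 \<le> Re (quad_form P (axis j 1 + axis i (- (P $ i $ j))))"
      using P by (simp add: pos_semidef_def)
    ultimately have "(cmod (P $ i $ j))\<^sup>2 \<le> 0" by simp
    then show ?thesis by simp
  qed
  then show ?thesis by (simp add: vec_eq_iff)
qed

text \<open>For self-adjoint \<open>P\<close> with nonzero pivot \<open>P $ i $ i\<close> this is v
  v* divided by the pivot, v being column \<open>i\<close>; subtracting it clears row and column
  \<open>i\<close>, as in one step of Gaussian elimination.\<close>

definition pivot_part :: "complex^'n^'n \<Rightarrow> 'n \<Rightarrow> complex^'n^'n" where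
  "pivot_part P i = (\<chi> a b. P $ a $ i * P $ i $ b / P $ i $ i)"

lemma quad_form_diff: "quad_form (A - B) x = quad_form A x - quad_form B x"
  by (simp add: quad_form_double_sum ring_distribs sum_subtractf)

text \<open>Completing the square: the form of the difference at \<open>x\<close> is the form of
  \<open>P\<close> at \<open>x\<close> shifted along axis \<open>i\<close> so that coordinate
  \<open>i\<close> of the image under \<open>P\<close> becomes zero.\<close>

lemma pos_semidef_schur_complement:
  fixes P :: "complex^'n^'n"
  assumes P: "pos_semidef P" and nz: "P $ i $ i \<noteq> 0"
  shows "pos_semidef (P - pivot_part P i)"
proof -
  have sa: "selfadjoint P" using P by (simp add: pos_semidef_def)
  have cP: "cnj (P $ a $ b) = P $ b $ a" for a b
    using sa by (simp add: selfadjoint_iff)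
  have "quad_form (P - pivot_part P i) x = quad_form P (x + axis i (- (P *v x) $ i / P $ i $ i))" for x
  proof -
    let ?w = "(P *v x) $ i"
    have "quad_form (pivot_part P i) x
        = (\<Sum>a\<in>UNIV. cnj (x $ a) * P $ a $ i) * (\<Sum>b\<in>UNIV. P $ i $ b * x $ b) / P $ i $ i"
      by (simp add: quad_form_double_sum pivot_part_def sum_product sum_divide_distrib mult_ac)
        (rule sum.swap)
    also have "(\<Sum>a\<in>UNIV. cnj (x $ a) * P $ a $ i) = cnj ?w"
      by (simp add: matrix_vector_mult_def cP mult.commute)
    also have "(\<Sum>b\<in>UNIV. P $ i $ b * x $ b) = ?w"
      by (simp add: matrix_vector_mult_def)
    finally show ?thesis
      using nz by (simp add: quad_form_diff quad_form_add_axis[OF sa] cP)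
  qed
  moreover have "selfadjoint (P - pivot_part P i)"
    by (simp add: selfadjoint_iff pivot_part_def cP mult.commute)
  ultimately show ?thesis using P by (simp add: pos_semidef_def)
qed

text \<open>Each Schur complement step splits off a rank one positive matrix and annihilates a diagonal
  entry; this replaces the spectral theorem.\<close>

lemma norm_trace_mult_pos_semidef_le:
  fixes P B :: "complex^'n^'n"
  assumes P: "pos_semidef P" and B: "op_norm B \<le> 1"
  shows "cmod (trace (B ** P)) \<le> Re (trace P)"
  using P
proof (induction "card {i. P $ i $ i \<noteq> 0}" arbitrary: P rule: less_induct)
  case (less P)
  show ?case
  proof (cases "\<forall>i. P $ i $ i = 0")
    case True
    then have "P = 0" using pos_semidef_eq_0 less.prems by blast
    then show ?thesis by (simp add: trace_def matrix_matrix_mult_def)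
  next
    case False
    then obtain i where nz: "P $ i $ i \<noteq> 0" by blast
    have cP: "cnj (P $ a $ b) = P $ b $ a" for a b
      using less.prems by (simp add: pos_semidef_def selfadjoint_iff)
    define p where "p = Re (P $ i $ i)"
    have Pii: "P $ i $ i = of_real p"
      using pos_semidef_diag(1)[OF less.prems] by (simp add: p_def)
    have p: "p > 0"
      using pos_semidef_diag(2)[OF less.prems, of i] nz Pii by (auto simp: order_less_le)
    define R where "R = pivot_part P i"
    define v where "v = column i P"
    have PR: "pos_semidef (P - R)"
      using pos_semidef_schur_complement[OF less.prems nz] by (simp add: R_def)
    have Raa: "R $ a $ a = of_real ((cmod (v $ a))\<^sup>2 / p)" for a
      by (simp add: R_def pivot_part_def Pii v_def column_def complex_norm_square cP del: of_real_power)
    \<comment> \<open>Vanishing diagonal entries must stay zero for the induction measure to drop.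
      Otherwise subtracting \<open>R\<close> would make such an entry negative, against positivity
      of \<open>P - R\<close>.\<close>
    have zero: "(P - R) $ a $ a = 0" if "P $ a $ a = 0" for a
    proof -
      have "0 \<le> - ((cmod (v $ a))\<^sup>2 / p)"
        using pos_semidef_diag(2)[OF PR, of a] that by (simp add: Raa)
      with p have "v $ a = 0" by (simp add: divide_le_0_iff)
      then show ?thesis using that by (simp add: Raa)
    qed
    have "(P - R) $ i $ i = 0"
      using nz by (simp add: R_def pivot_part_def)
    then have "{a. (P - R) $ a $ a \<noteq> 0} \<subset> {a. P $ a $ a \<noteq> 0}"
      using nz zero by blast
    then have "card {a. (P - R) $ a $ a \<noteq> 0} < card {a. P $ a $ a \<noteq> 0}"
      by (intro psubset_card_mono) auto
    from less.hyps[OF this PR]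
    have IH: "cmod (trace (B ** (P - R))) \<le> Re (trace (P - R))" .
    have trR: "Re (trace R) = (norm v)\<^sup>2 / p"
      by (simp add: trace_def Raa norm_vec_def L2_set_def sum_nonneg sum_divide_distrib)
    \<comment> \<open>Since \<open>R\<close> is v v* / \<open>p\<close>, its trace against
      \<open>B\<close> is a value of the form of \<open>B\<close>, and
      \<open>norm_quad_form_le\<close> compares it with the trace of \<open>R\<close>.\<close>
    have "trace (B ** R) = quad_form B v / of_real p"
      by (simp add: trace_def matrix_matrix_mult_def quad_form_double_sum R_def pivot_part_def
          Pii v_def column_def cP sum_divide_distrib mult_ac)
    then have "cmod (trace (B ** R)) \<le> Re (trace R)"
      using norm_quad_form_le[OF B, of v] p by (simp add: norm_divide trR divide_right_mono)
    moreover have "B ** P = B ** (P - R) + B ** R"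
      by (simp add: matrix_add_ldistrib[symmetric])
    then have "cmod (trace (B ** P)) \<le> cmod (trace (B ** (P - R))) + cmod (trace (B ** R))"
      by (simp add: trace_add norm_triangle_ineq)
    ultimately show ?thesis using IH by (simp add: trace_sub)
  qed
qed

section \<open>The coefficient estimate and the inequality for r up to 1/3\<close>

lemma norm_trace_mult_conj_transpose_le:
  fixes A S B :: "complex^'n^'n"
  assumes S: "selfadjoint S" and le: "loewner_le (re_part A) S"
    and SB: "trace (S ** B) = 0" and AB: "trace (A ** B) = 0" and B: "op_norm B \<le> 1"
  shows "cmod (trace (A ** conj_transpose B)) \<le> 2 * (Re (trace S) - Re (trace A))"
proof -
  have P: "pos_semidef (S - re_part A)"
    using le by (simp add: loewner_le_def)
  have "trace (B ** A) = 0" "trace (B ** S) = 0"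
    using SB AB by (metis trace_mul_sym)+
  moreover have "trace (B ** re_part A) = (trace (B ** A) + trace (B ** conj_transpose A)) / 2"
    by (simp add: re_part_nth conj_transpose_def trace_def matrix_matrix_mult_def sum.distrib
        ring_distribs sum_divide_distrib add_divide_distrib)
  moreover have "B ** S = B ** (S - re_part A) + B ** re_part A"
    by (simp add: matrix_add_ldistrib[symmetric])
  then have "trace (B ** S) = trace (B ** (S - re_part A)) + trace (B ** re_part A)"
    by (simp add: trace_add)
  ultimately have "trace (B ** conj_transpose A) = - 2 * trace (B ** (S - re_part A))"
    by (simp add: field_simps eq_neg_iff_add_eq_0)
  moreover have "trace (A ** conj_transpose B) = cnj (trace (B ** conj_transpose A))"
    by (simp add: trace_conj_transpose[symmetric] conj_transpose_mult conj_transpose_conj_transpose)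
  ultimately have "cmod (trace (A ** conj_transpose B)) = 2 * cmod (trace (B ** (S - re_part A)))"
    by (simp add: norm_mult)
  also have "\<dots> \<le> 2 * Re (trace (S - re_part A))"
    using norm_trace_mult_pos_semidef_le[OF P B] by simp
  also have "Re (trace (re_part A)) = Re (trace A)"
    by (simp add: trace_def re_part_nth)
  then have "2 * Re (trace (S - re_part A)) = 2 * (Re (trace S) - Re (trace A))"
    by (simp add: trace_sub)
  finally show ?thesis .
qed

lemma bohr_ineq_one_third:
  fixes A S :: "complex^'n^'n"
  assumes tr: "trace A \<in> \<real>" "0 \<le> Re (trace A)"
    and S: "selfadjoint S" "loewner_le (re_part A) S"
    and B: "\<forall>m\<ge>1. trace (S ** B m) = 0 \<and> trace (A ** B m) = 0 \<and> op_norm (B m) \<le> 1"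
    and r: "0 \<le> r" "r \<le> 1/3"
  shows "bohr_ineq S A B r"
proof -
  define f where "f m = cmod (coeff_seq A B m) * r ^ m" for m
  define d where "d = Re (trace S) - Re (trace A)"
  have bound: "cmod (coeff_seq A B (Suc m)) \<le> 2 * d" for m
    using norm_trace_mult_conj_transpose_le[OF S, of "B (Suc m)"] B by (simp add: coeff_seq_def d_def)
  \<comment> \<open>The bound on the coefficient of index 1 already forces \<open>d\<close> to be
    nonnegative.\<close>
  have d: "0 \<le> d" using bound[of 0] norm_ge_zero[of "coeff_seq A B (Suc 0)"] by linarith
  have le: "f (Suc m) \<le> 2 * d * r * r ^ m" for m
    using mult_right_mono[OF bound[of m], of "r ^ Suc m"] r by (simp add: f_def mult_ac)
  have sg: "(\<lambda>m. 2 * d * r * r ^ m) sums (2 * d * r * (1 / (1 - r)))"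
    using r by (intro sums_mult geometric_sums) auto
  have summ: "summable (\<lambda>m. f (Suc m))"
    by (rule summable_comparison_test'[OF sums_summable[OF sg], of 0]) (use le r in \<open>auto simp: f_def\<close>)
  then have sf: "summable f" by (simp add: summable_Suc_iff)
  have "(\<Sum>m. f (Suc m)) \<le> 2 * d * r * (1 / (1 - r))"
    using suminf_le[OF le summ sums_summable[OF sg]] sums_unique[OF sg] by simp
  also have "\<dots> = d * (2 * r / (1 - r))" by simp
  \<comment> \<open>For r < 1, the condition 2r/(1 - r) \<le> 1 says exactly that r \<le>
    1/3.\<close>
  also have "\<dots> \<le> d * 1"
    using d r by (intro mult_left_mono) (auto simp: field_simps)
  finally have "(\<Sum>m. f (Suc m)) \<le> d" by simp
  moreover have "f 0 = Re (trace A)"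
    using tr by (auto simp: f_def coeff_seq_def elim!: Reals_cases)
  ultimately have "suminf f \<le> Re (trace S)"
    using suminf_split_head[OF sf] by (simp add: d_def)
  with sf show ?thesis by (simp add: bohr_ineq_def f_def[abs_def])
qed

section \<open>Optimality of 1/3\<close>

text \<open>The matrices of the counterexample live on two indices, so their traces and products
  reduce to two-term sums.\<close>

lemma sum_two:
  fixes f :: "'n::finite \<Rightarrow> 'b::comm_monoid_add"
  assumes "i \<noteq> j" and "\<And>k. k \<noteq> i \<Longrightarrow> k \<noteq> j \<Longrightarrow> f k = 0"
  shows "sum f UNIV = f i + f j"
proof -
  have "sum f UNIV = sum f {i, j}"
    by (rule sum.mono_neutral_right) (use assms in auto)
  then show ?thesis using assms by simp
qed

lemma not_bohr_ineq_above_one_third: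
  fixes r :: real
  assumes card: "CARD('n) \<ge> 2" and r: "r > 1/3"
  shows "\<exists>(A :: complex^'n^'n) S B.
               trace A \<in> \<real> \<and> 0 \<le> Re (trace A) \<and>
               selfadjoint S \<and> loewner_le (re_part A) S \<and>
               (\<forall>m\<ge>1. trace (S ** B m) = 0 \<and> trace (A ** B m) = 0 \<and> op_norm (B m) \<le> 1) \<and>
               \<not> bohr_ineq S A B r"
proof -
  obtain i j :: 'n where ij: "i \<noteq> j"
  proof -
    have "\<exists>i j :: 'n. i \<noteq> j"
    proof (rule ccontr)
      assume "\<not> ?thesis"
      then have "CARD('n) \<le> 1" by (auto simp: card_le_Suc0_iff_eq)
      with card show False by simp
    qed
    then show ?thesis using that by blast
  qed
  \<comment> \<open>The second argument is the value of c at which 2cr/(1 - r) = 1, and it is below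
    1 because r > 1/3. The maximum with 0 keeps c positive when r \<ge> 1.\<close>
  have "max 0 ((1 - r) / (2 * r)) < 1" using r by (simp add: field_simps)
  then obtain c where c: "0 < c" "c < 1" "(1 - r) / (2 * r) < c"
    using dense by (metis max_less_iff_conj)
  \<comment> \<open>This value makes Tr(SU) = c - k(1 - c) vanish.\<close>
  define k where "k = c / (1 - c)"
  have k: "k * (1 - c) = c" using c by (simp add: k_def)
  define A :: "complex^'n^'n" where "A = (\<chi> a b. if a = i \<and> b = j then of_real (- 2 * k) else 0)"
  define S :: "complex^'n^'n" where "S = (\<chi> a b. if a = i \<and> b = i then 1
     else if a = i \<and> b = j \<or> a = j \<and> b = i then of_real (- k) else 0)"
  define U :: "complex^'n^'n" where "U = (\<chi> a b. if a = i then
     if b = i then of_real c else if b = j then of_real (1 - c) else 0 else 0)"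
  \<comment> \<open>The off-diagonal entries of \<open>S\<close> are those of
    \<open>re_part A\<close>, so only a rank one projection is left.\<close>
  have SA: "S - re_part A = (\<chi> a b. if a = i \<and> b = i then 1 else 0)"
    using ij by (auto simp: vec_eq_iff S_def A_def re_part_nth)
  have qf: "quad_form (S - re_part A) x = of_real ((cmod (x $ i))\<^sup>2)" for x
  proof -
    have "quad_form (S - re_part A) x = cnj (x $ i) * x $ i"
      unfolding quad_form_double_sum SA by (simp add: sum_two[OF ij] ij[symmetric])
    then show ?thesis by (simp only: complex_norm_square mult.commute)
  qed
  have psd: "pos_semidef (S - re_part A)"
    unfolding pos_semidef_def qf by (auto simp: selfadjoint_iff SA)
  have saS: "selfadjoint S" using ij by (auto simp: selfadjoint_iff S_def)
  have saA: "selfadjoint (re_part A)"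
    by (simp add: selfadjoint_iff re_part_nth add.commute)
  have trA: "trace A = 0" using ij by (auto simp: trace_def A_def intro!: sum.neutral)
  have trS: "trace S = 1" using ij by (simp add: trace_def S_def sum_two[OF ij])
  have SU: "trace (S ** U) = 0"
    using ij arg_cong[OF k, of complex_of_real]
    by (simp add: trace_def matrix_matrix_mult_def sum_two[OF ij] S_def U_def)
  have AU: "trace (A ** U) = 0"
    using ij by (simp add: trace_def matrix_matrix_mult_def sum_two[OF ij] A_def U_def)
  have AUs: "trace (A ** conj_transpose U) = of_real (- 2 * c)"
    using ij arg_cong[OF k, of complex_of_real]
    by (simp add: trace_def matrix_matrix_mult_def sum_two[OF ij] A_def U_def conj_transpose_def)
  have opU: "op_norm U \<le> 1"
    unfolding op_norm_def
  proof (rule onorm_le)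
    fix x :: "complex^'n"
    \<comment> \<open>The image has a single coordinate, a convex combination of two coordinates of
      \<open>x\<close>, hence of modulus at most \<open>norm x\<close>.\<close>
    have "U *v x = axis i (of_real c * x $ i + of_real (1 - c) * x $ j)"
      using ij by (auto simp: vec_eq_iff matrix_vector_mult_def axis_def U_def sum_two[OF ij])
    then have "norm (U *v x) = cmod (of_real c * x $ i + of_real (1 - c) * x $ j)"
      by (simp add: norm_vec_def L2_set_def axis_def if_distrib[of "\<lambda>z. (cmod z)\<^sup>2"] cong: if_cong)
    also have "\<dots> \<le> c * cmod (x $ i) + (1 - c) * cmod (x $ j)"
      using c norm_triangle_ineq[of "of_real c * x $ i" "of_real (1 - c) * x $ j"]
      by (simp only: norm_mult norm_of_real abs_of_nonneg)
    also have "\<dots> \<le> c * norm x + (1 - c) * norm x"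
      using c by (intro add_mono mult_left_mono Finite_Cartesian_Product.norm_nth_le) auto
    finally show "norm (U *v x) \<le> 1 * norm x" by (simp add: algebra_simps)
  qed
  have "\<not> bohr_ineq S A (\<lambda>_. U) r"
  proof
    define f where "f m = cmod (coeff_seq A (\<lambda>_. U) m) * r ^ m" for m
    assume "bohr_ineq S A (\<lambda>_. U) r"
    then have sf: "summable f" and le: "suminf f \<le> 1"
      by (auto simp: bohr_ineq_def f_def[abs_def] trS)
    have f0: "f 0 = 0" and fS: "f (Suc m) = 2 * c * r * r ^ m" for m
      using c by (auto simp: f_def coeff_seq_def trA AUs norm_mult)
    \<comment> \<open>For r \<ge> 1 the inequality already fails by divergence; summability leaves r
      < 1, where the series can be evaluated.\<close>
    have "summable (\<lambda>m. 2 * c * r * r ^ m)"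
      using sf by (simp add: summable_Suc_iff[of f, symmetric] fS)
    then have "summable (\<lambda>m. r ^ m)"
      using c r by (auto simp: summable_cmult_iff)
    then have r1: "r < 1" using r by (simp add: summable_geometric_iff)
    have "(\<lambda>m. 2 * c * r * r ^ m) sums (2 * c * r * (1 / (1 - r)))"
      using r r1 by (intro sums_mult geometric_sums) auto
    then have "(\<Sum>m. f (Suc m)) = 2 * c * r / (1 - r)"
      by (simp add: fS sums_unique[symmetric])
    then have "2 * c * r / (1 - r) \<le> 1"
      using le suminf_split_head[OF sf] f0 by simp
    with c r r1 show False by (simp add: field_simps)
  qed
  then show ?thesis
    using trA SU AU opU saS saA psd
    by (intro exI[of _ A] exI[of _ S] exI[of _ "\<lambda>_. U"]) (simp add: loewner_le_def)
qed

theorem mainTheorem3: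
  shows "(\<forall>(A :: complex^'n^'n) S B r.
            trace A \<in> \<real> \<and> 0 \<le> Re (trace A) \<and>
            selfadjoint S \<and> loewner_le (re_part A) S \<and>
            (\<forall>m\<ge>1. trace (S ** B m) = 0 \<and> trace (A ** B m) = 0 \<and> op_norm (B m) \<le> 1) \<and>
            0 \<le> r \<and> r \<le> 1/3
            \<longrightarrow> bohr_ineq S A B r)
       \<and> (CARD('n) \<ge> 2 \<longrightarrow>
          (\<forall>r::real. r > 1/3 \<longrightarrow>
            (\<exists>(A :: complex^'n^'n) S B.
               trace A \<in> \<real> \<and> 0 \<le> Re (trace A) \<and>
               selfadjoint S \<and> loewner_le (re_part A) S \<and>
               (\<forall>m\<ge>1. trace (S ** B m) = 0 \<and> trace (A ** B m) = 0 \<and> op_norm (B m) \<le> 1) \<and>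
               \<not> bohr_ineq S A B r)))"
  by (intro conjI allI impI not_bohr_ineq_above_one_third)
    (auto intro!: bohr_ineq_one_third)

end
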